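(* Let $\gamma_1(s)=(x_1(s),y_1(s))$ and $\gamma_2(s)=(x_2(s),y_2(s))$, $0\le s<2\pi$, be two simple closed piecewise $C^1$ curves in the plane which are the boundaries of the (bounded) sets $A_1$ and $A_2$ they enclose. Let $A=A_1\cap A_2\neq\emptyset$ be such that $\mathrm{Area}(A)>0$, and let the boundary of $A$ be the simple closed piecewise $C^1$ curve $\gamma(s)=(x(s),y(s))$, $0\le s<2\pi$. Put $$\varepsilon=\max\{|x-x_2|,\,|y-y_2|,\,|x'-x_2'|,\,|y'-y_2'|\},$$ $$M=2\max\{|x|,|x_2|,|y|,|y_2|,|x'|,|x_2'|,|y'|,|y_2'|\},$$ where the maxima (suprema) are taken over the listed functions and over all $s\in[0,2\pi)$ at which they are defined, and define $$\Delta(\varepsilon)=\frac{2\pi M\varepsilon}{\mathrm{Area}(A_2)}.$$ Then $$1\ge\alpha(A_1,A_2,0)\ge 1-\Delta(\varepsilon).$$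
   Context: For measurable nonempty sets $A,B\subset\mathbb{R}^2$ and an area-preserving flow $\Phi_t$, the shape coherence factor after time $T$ is $$\alpha(A,B,T)=\sup_{S}\frac{m(S(B)\cap\Phi_T(A))}{m(B)},$$ where $m$ is Lebesgue measure (area) and the supremum is over all rigid body motions $S$ of the plane (translations and rotations and their compositions). Since $\Phi_0$ is the identity, $\alpha(A_1,A_2,0)=\sup_S m(S(A_2)\cap A_1)/m(A_2)$. Primes denote $d/ds$. *)

theory Defs
  imports "HOL-Analysis.Analysis"
begin

definition rotation :: "real \<Rightarrow> real \<times> real \<Rightarrow> real \<times> real \<Rightarrow> real \<times> real" where
  "rotation \<theta> c p =
     c + (cos \<theta> * fst (p - c) - sin \<theta> * snd (p - c),
          sin \<theta> * fst (p - c) + cos \<theta> * snd (p - c))"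

text \<open>No reflections: only translations, rotations about arbitrary centres, and their compositions.\<close>

inductive_set rigid_motions :: "(real \<times> real \<Rightarrow> real \<times> real) set" where
  translation: "(\<lambda>p. a + p) \<in> rigid_motions"
| rotation: "rotation \<theta> c \<in> rigid_motions"
| comp: "S \<in> rigid_motions \<Longrightarrow> R \<in> rigid_motions \<Longrightarrow> S \<circ> R \<in> rigid_motions"

text \<open>
  A flow is a continuous family of bijections of the plane starting at the identity. The group law
  \<open>\<Phi> (s + t) = \<Phi> s \<circ> \<Phi> t\<close> is not demanded, so the time-\<open>t\<close> maps of a time-dependent velocity
  field are covered as well.
\<close>

definition area_preserving_flow :: "(real \<Rightarrow> real \<times> real \<Rightarrow> real \<times> real) \<Rightarrow> bool" where
  "area_preserving_flow \<Phi> \<longleftrightarrow>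
     \<Phi> 0 = id \<and>
     continuous_on UNIV (\<lambda>(t, p). \<Phi> t p) \<and>
     (\<forall>t. bij (\<Phi> t)) \<and>
     (\<forall>t. \<forall>X \<in> sets lebesgue. \<Phi> t ` X \<in> sets lebesgue \<and>
        emeasure lebesgue (\<Phi> t ` X) = emeasure lebesgue X)"

text \<open>
  The real-valued supremum is the intended one when \<open>B\<close> has finite positive area: the quotients
  then lie between 0 and 1, since rigid motions preserve area.
\<close>

definition shape_coherence ::
  "(real \<Rightarrow> real \<times> real \<Rightarrow> real \<times> real) \<Rightarrow> (real \<times> real) set \<Rightarrow> (real \<times> real) set \<Rightarrow> real \<Rightarrow> real" where
  "shape_coherence \<Phi> A B T =
     (SUP S \<in> rigid_motions. measure lebesgue (S ` B \<inter> \<Phi> T ` A) / measure lebesgue B)"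

text \<open>
  Piecewise \<open>C\<^sup>1\<close> in the usual sense: \<open>C\<^sup>1\<close> up to the end points on each closed interval of a finite
  subdivision. The library predicate \<^const>\<open>piecewise_C1_differentiable_on\<close> is weaker: it admits
  derivatives that are unbounded near a break point. Since \<^const>\<open>C1_differentiable_on\<close> uses
  two-sided derivatives, each piece is required to agree with a function \<open>g\<close> that is also defined
  beyond the piece.
\<close>

definition piecewise_C1 :: "(real \<Rightarrow> 'a::real_normed_vector) \<Rightarrow> real \<Rightarrow> real \<Rightarrow> bool" where
  "piecewise_C1 f a b \<longleftrightarrow>
     continuous_on {a..b} f \<and>
     (\<exists>P. finite P \<and> {a, b} \<subseteq> P \<and> P \<subseteq> {a..b} \<and>
        (\<forall>u\<in>P. \<forall>v\<in>P. u < v \<and> {u<..<v} \<inter> P = {} \<longrightarrow>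
           (\<exists>g. g C1_differentiable_on {u..v} \<and> (\<forall>t\<in>{u..v}. g t = f t))))"

text \<open>
  A closed curve parametrized by \<open>0 \<le> s < 2\<pi>\<close>; its closing is expressed by the value at \<open>2\<pi>\<close>.
\<close>

definition simple_closed_piecewise_C1 :: "(real \<Rightarrow> real \<times> real) \<Rightarrow> bool" where
  "simple_closed_piecewise_C1 \<gamma> \<longleftrightarrow>
     piecewise_C1 \<gamma> 0 (2 * pi) \<and> \<gamma> (2 * pi) = \<gamma> 0 \<and> inj_on \<gamma> {0..<2 * pi}"

definition curve_image :: "(real \<Rightarrow> real \<times> real) \<Rightarrow> (real \<times> real) set" where
  "curve_image \<gamma> = \<gamma> ` {0..<2 * pi}"

text \<open>
  Which boundary points belong to the enclosed set is left open, so \<open>A\<close> may be the open region,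
  the closed region, or anything in between. The condition on \<^const>\<open>inside\<close> excludes sets such as
  the curve itself, which is its own frontier.
\<close>

definition encloses :: "(real \<Rightarrow> real \<times> real) \<Rightarrow> (real \<times> real) set \<Rightarrow> bool" where
  "encloses \<gamma> A \<longleftrightarrow> bounded A \<and> frontier A = curve_image \<gamma> \<and> inside (curve_image \<gamma>) \<subseteq> A"

text \<open>
  Derivatives are those of the function restricted to \<open>[0, 2\<pi>)\<close>, thus one-sided at 0;
  \<open>drv_dom f\<close> is the set of parameters at which this derivative exists.
\<close>

definition drv_dom :: "(real \<Rightarrow> real) \<Rightarrow> real set" where
  "drv_dom f = {s \<in> {0..<2 * pi}. f differentiable (at s within {0..<2 * pi})}"

definition drv :: "(real \<Rightarrow> real) \<Rightarrow> real \<Rightarrow> real" where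
  "drv f s = vector_derivative f (at s within {0..<2 * pi})"

text \<open>For piecewise \<open>C\<^sup>1\<close> functions the following suprema are over nonempty bounded sets.\<close>

definition curve_eps ::
  "(real \<Rightarrow> real) \<Rightarrow> (real \<Rightarrow> real) \<Rightarrow> (real \<Rightarrow> real) \<Rightarrow> (real \<Rightarrow> real) \<Rightarrow> real" where
  "curve_eps x y x\<^sub>2 y\<^sub>2 =
     Sup ((\<lambda>s. \<bar>x s - x\<^sub>2 s\<bar>) ` {0..<2 * pi} \<union>
          (\<lambda>s. \<bar>y s - y\<^sub>2 s\<bar>) ` {0..<2 * pi} \<union>
          (\<lambda>s. \<bar>drv x s - drv x\<^sub>2 s\<bar>) ` (drv_dom x \<inter> drv_dom x\<^sub>2) \<union>
          (\<lambda>s. \<bar>drv y s - drv y\<^sub>2 s\<bar>) ` (drv_dom y \<inter> drv_dom y\<^sub>2))"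

definition curve_M ::
  "(real \<Rightarrow> real) \<Rightarrow> (real \<Rightarrow> real) \<Rightarrow> (real \<Rightarrow> real) \<Rightarrow> (real \<Rightarrow> real) \<Rightarrow> real" where
  "curve_M x y x\<^sub>2 y\<^sub>2 =
     2 * Sup (\<Union>f \<in> {x, x\<^sub>2, y, y\<^sub>2}. (\<lambda>s. \<bar>f s\<bar>) ` {0..<2 * pi} \<union> (\<lambda>s. \<bar>drv f s\<bar>) ` drv_dom f)"

end

theory Submission
  imports Defs "HOL-Complex_Analysis.Winding_Numbers"
begin

text \<open>
  The upper bound holds because rigid motions preserve area. For the lower bound the identity already
  suffices as a competitor: it gives \<open>area A / area A\<^sub>2\<close>, so it remains to bound
  \<open>area A\<^sub>2 - area A\<close> by \<open>2 * pi * M * \<epsilon>\<close>.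

  Connect \<open>\<gamma> s\<close> to \<open>\<gamma>\<^sub>2 s\<close> by a segment for each parameter \<open>s\<close>. The union of these segments, the swept
  region, contains \<open>A\<^sub>2 - A\<close>: a point \<open>p\<close> of \<open>A\<^sub>2 - A\<close> off all segments would lie inside \<open>\<gamma>\<^sub>2\<close> and outside
  \<open>\<gamma>\<close>, so that \<open>\<gamma>\<^sub>2\<close> winds once around it and \<open>\<gamma>\<close> does not wind around it at all; but the straight-line
  homotopy from \<open>\<gamma>\<close> to \<open>\<gamma>\<^sub>2\<close> avoids \<open>p\<close> and preserves the winding number
  (\<open>region_difference_covered_by_segments\<close>).

  The swept region is the image of \<open>(s, t) \<mapsto> (1 - t) \<gamma> s + t \<gamma>\<^sub>2 s\<close> on \<open>[0, 2\<pi>] \<times> [0, 1]\<close>. The Jacobian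
  determinant of this map is the cross product of an average of \<open>\<gamma>' s\<close> and \<open>\<gamma>\<^sub>2' s\<close>, whose coordinates are at most
  \<open>M / 2\<close>, with \<open>\<gamma>\<^sub>2 s - \<gamma> s\<close>, whose coordinates are at most \<open>\<epsilon>\<close>. It is therefore at most \<open>M * \<epsilon>\<close> in absolute
  value, and integrating over the rectangle gives the bound (\<open>measure_swept_region_le\<close>).

  Comparing areas through the swept region, rather than by Green's formula for each area, makes the
  argument independent of the orientations of the curves.
\<close>

section \<open>Area in product and vector coordinates, and rigid motions\<close>

text \<open>
  Area is needed on \<open>real \<times> real\<close>, whereas determinants and the change-of-variables theorem live on
  \<open>real^2\<close>. The two coordinate maps below carry Lebesgue measure back and forth.
\<close>

definition to_pair :: "real^2 \<Rightarrow> real \<times> real" where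
  "to_pair v = (v $ 1, v $ 2)"

definition of_pair :: "real \<times> real \<Rightarrow> real^2" where
  "of_pair p = vector [fst p, snd p]"

lemma to_pair_of_pair [simp]: "to_pair (of_pair p) = p"
  by (simp add: to_pair_def of_pair_def)

lemma of_pair_to_pair [simp]: "of_pair (to_pair v) = v"
  by (simp add: to_pair_def of_pair_def vec_eq_iff forall_2)

lemma linear_of_pair: "linear of_pair"
  by (rule linearI) (simp_all add: of_pair_def vec_eq_iff forall_2)

lemma linear_to_pair: "linear to_pair"
  by (rule linearI) (simp_all add: to_pair_def)

lemma vimage_to_pair: "to_pair -` S = of_pair ` S"
proof -
  have "bij to_pair" by (rule o_bij[of of_pair]) auto
  then show ?thesis
    by (simp add: bij_vimage_eq_inv_image inv_equality[of of_pair])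
qed

lemma vimage_of_pair: "of_pair -` S = to_pair ` S"
proof -
  have "bij of_pair" by (rule o_bij[of to_pair]) auto
  then show ?thesis
    by (simp add: bij_vimage_eq_inv_image inv_equality[of to_pair])
qed

text \<open>
  Borel measure is determined by the volume of boxes, and the coordinate map takes boxes to boxes with the
  same side lengths.
\<close>

lemma lborel_to_pair: "distr lborel borel to_pair = lborel"
proof (rule lborel_eqI[symmetric])
  fix l u :: "real \<times> real"
  assume lu: "\<And>b. b \<in> Basis \<Longrightarrow> l \<bullet> b \<le> u \<bullet> b"
  have le: "fst l \<le> fst u" "snd l \<le> snd u"
    using lu[of "(1, 0)"] lu[of "(0, 1)"] by (auto simp: Basis_prod_def inner_prod_def)
  have meas: "to_pair \<in> borel_measurable lborel"
    using linear_continuous_on[OF linear_to_pair[THEN linear_conv_bounded_linear[THEN iffD1]], of UNIV]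
    by (simp add: borel_measurable_continuous_onI)
  have vim: "to_pair -` box l u = box (of_pair l) (of_pair u)"
    by (auto simp: to_pair_def of_pair_def mem_box_cart forall_2 mem_box Basis_prod_def
        inner_prod_def)
  have "emeasure (distr lborel borel to_pair) (box l u) = emeasure lborel (box (of_pair l) (of_pair u))"
    using meas by (simp add: emeasure_distr vim)
  also have "\<dots> = (\<Prod>b\<in>Basis. (of_pair u - of_pair l) \<bullet> b)"
  proof (rule emeasure_lborel_box)
    fix b :: "real^2" assume "b \<in> Basis"
    then obtain i where "b = axis i 1" by (auto simp: Basis_vec_def)
    then show "of_pair l \<bullet> b \<le> of_pair u \<bullet> b"
      using le exhaust_2[of i] by (auto simp: inner_axis of_pair_def)
  qed
  also have "(\<Prod>b\<in>Basis. (of_pair u - of_pair l) \<bullet> b) = (fst u - fst l) * (snd u - snd l)"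
  proof -
    have B: "(Basis :: (real^2) set) = {axis 1 1, axis 2 1}"
      by (auto simp: Basis_vec_def) (metis exhaust_2)
    have "axis 1 1 \<noteq> (axis 2 1 :: real^2)" by (simp add: axis_eq_axis)
    then show ?thesis by (simp add: B inner_axis of_pair_def)
  qed
  also have "(fst u - fst l) * (snd u - snd l) = (\<Prod>b\<in>Basis. (u - l) \<bullet> b)"
  proof -
    have B: "(Basis :: (real \<times> real) set) = {(1,0), (0,1)}"
      by (auto simp: Basis_prod_def)
    show ?thesis by (simp add: B inner_prod_def)
  qed
  finally show "emeasure (distr lborel borel to_pair) (box l u) = (\<Prod>b\<in>Basis. (u - l) \<bullet> b)" .
qed simp

lemma lborel_of_pair: "distr lborel borel of_pair = lborel"
proof -
  have meas: "to_pair \<in> borel_measurable borel" "of_pair \<in> borel_measurable borel"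
    using linear_to_pair linear_of_pair
    by (auto intro!: borel_measurable_continuous_onI linear_continuous_on
        simp: linear_conv_bounded_linear)
  have "distr lborel borel of_pair = distr (distr lborel borel to_pair) borel of_pair"
    by (simp add: lborel_to_pair)
  also have "\<dots> = distr lborel borel (of_pair \<circ> to_pair)"
    using meas by (subst distr_distr) auto
  also have "of_pair \<circ> to_pair = (\<lambda>v. v)"
    by auto
  finally show ?thesis
    by (metis distr_id2 sets_lborel)
qed

text \<open>
  Preservation of Borel measure passes to its completion, hence to all Lebesgue measurable sets.
\<close>

lemma lmeasurable_vimage_of_lborel_distr:
  fixes h :: "'a::euclidean_space \<Rightarrow> 'b::euclidean_space"
  assumes h: "h \<in> borel_measurable borel" and d: "distr lborel borel h = lborel"
    and S: "S \<in> lmeasurable"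
  shows "h -` S \<in> lmeasurable" and "measure lebesgue (h -` S) = measure lebesgue S"
proof -
  have h': "h \<in> lebesgue \<rightarrow>\<^sub>M lborel"
    using h by (intro measurable_completion) simp
  have dd: "distr lebesgue lborel h = lborel"
    using d h by (simp add: distr_completion cong: distr_cong)
  have "completion (distr lebesgue lborel h) = distr lebesgue lebesgue h"
    by (rule completion.completion_distr_eq[OF h']) (simp only: dd)
  then have eq: "distr lebesgue lebesgue h = lebesgue"
    by (simp add: dd)
  have hl: "h \<in> lebesgue \<rightarrow>\<^sub>M lebesgue"
    by (rule completion.measurable_completion2[OF h']) (simp only: dd order_refl)
  have SS: "S \<in> sets lebesgue" using S by (simp add: fmeasurableD)
  have sets: "h -` S \<in> sets lebesgue"
    using measurable_sets[OF hl SS] by simp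
  have em: "emeasure lebesgue (h -` S) = emeasure lebesgue S"
    using emeasure_distr[OF hl SS] by (simp add: eq)
  show "h -` S \<in> lmeasurable"
    using fmeasurableI[OF sets] fmeasurableD2[OF S] by (simp only: em less_top infinity_ennreal_def)
  show "measure lebesgue (h -` S) = measure lebesgue S"
    using em by (simp add: measure_def)
qed

lemma
  assumes "S \<in> lmeasurable"
  shows lmeasurable_of_pair_image: "of_pair ` S \<in> lmeasurable"
    and measure_of_pair_image: "measure lebesgue (of_pair ` S) = measure lebesgue S"
  using lmeasurable_vimage_of_lborel_distr[OF _ lborel_to_pair assms] linear_to_pair
  by (auto simp: vimage_to_pair linear_conv_bounded_linear
      intro!: borel_measurable_continuous_onI linear_continuous_on)

lemma
  assumes "S \<in> lmeasurable"
  shows lmeasurable_to_pair_image: "to_pair ` S \<in> lmeasurable"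
    and measure_to_pair_image: "measure lebesgue (to_pair ` S) = measure lebesgue S"
  using lmeasurable_vimage_of_lborel_distr[OF _ lborel_of_pair assms] linear_of_pair
  by (auto simp: vimage_of_pair linear_conv_bounded_linear
      intro!: borel_measurable_continuous_onI linear_continuous_on)

lemma orthogonal_transformation_planar_rotation:
  "orthogonal_transformation (\<lambda>v::real^2. of_pair (rotation \<theta> 0 (to_pair v)))"
  unfolding orthogonal_transformation_def
proof (intro conjI allI)
  show "linear (\<lambda>v::real^2. of_pair (rotation \<theta> 0 (to_pair v)))"
    by (rule linearI)
      (simp_all add: of_pair_def to_pair_def rotation_def vec_eq_iff forall_2 algebra_simps)
  fix v w :: "real^2"
  have "(cos \<theta> * v1 - sin \<theta> * v2) * (cos \<theta> * w1 - sin \<theta> * w2) +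
      (sin \<theta> * v1 + cos \<theta> * v2) * (sin \<theta> * w1 + cos \<theta> * w2) =
      ((sin \<theta>)\<^sup>2 + (cos \<theta>)\<^sup>2) * (v1 * w1 + v2 * w2)" for v1 v2 w1 w2
    by algebra
  then show "of_pair (rotation \<theta> 0 (to_pair v)) \<bullet> of_pair (rotation \<theta> 0 (to_pair w)) = v \<bullet> w"
    by (simp add: of_pair_def to_pair_def rotation_def inner_vec_def sum_2)
qed

lemma rigid_motion_lmeasurable:
  assumes "S \<in> rigid_motions" "X \<in> lmeasurable"
  shows "S ` X \<in> lmeasurable \<and> measure lebesgue (S ` X) = measure lebesgue X"
  using assms
proof (induction arbitrary: X)
  case (translation a)
  then show ?case by (simp add: measurable_translation measure_translation)
next
  case (rotation \<theta> c)
  define T where "T = (\<lambda>v. of_pair (rotation \<theta> 0 (to_pair v)))"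
  define Y where "Y = of_pair ` ((+) (- c) ` X)"
  have Y: "Y \<in> lmeasurable" "measure lebesgue Y = measure lebesgue X"
    using measurable_translation[OF rotation, of "- c"]
      measure_translation[of "- c" X]
    by (simp_all add: Y_def lmeasurable_of_pair_image measure_of_pair_image)
  have T: "orthogonal_transformation T"
    unfolding T_def by (rule orthogonal_transformation_planar_rotation)
  have TY: "T ` Y \<in> lmeasurable" "measure lebesgue (T ` Y) = measure lebesgue X"
    using measurable_orthogonal_image[OF T Y(1)] measure_orthogonal_image[OF T Y(1)] Y(2) by auto
  \<comment> \<open>A rotation about \<open>c\<close> is the linear rotation conjugated by the translation by \<open>c\<close>.\<close>
  have "rotation \<theta> c ` X = (+) c ` (to_pair ` (T ` Y))"
    by (simp add: image_image T_def Y_def rotation_def)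
  then show ?case
    using TY by (simp add: lmeasurable_to_pair_image measure_to_pair_image
        measurable_translation measure_translation)
next
  case (comp S R)
  then show ?case by (metis image_comp)
qed

section \<open>Regions with a Jordan curve as frontier\<close>

text \<open>
  A connected set that meets both \<open>A\<close> and its complement meets the frontier of \<open>A\<close>. The exterior of a Jordan
  curve is connected and, being unbounded, is not contained in \<open>A\<close>; so it misses \<open>A\<close> when the curve is the
  frontier of \<open>A\<close>.
\<close>

lemma bounded_disjoint_outside:
  fixes g :: "real \<Rightarrow> complex"
  assumes g: "simple_path g" "pathfinish g = pathstart g"
    and A: "bounded A" "frontier A = path_image g"
  shows "outside (path_image g) \<inter> A = {}"
proof (rule ccontr)
  assume ne: "outside (path_image g) \<inter> A \<noteq> {}"
  have J: "connected (outside (path_image g))" "\<not> bounded (outside (path_image g))"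
    using Jordan_inside_outside[OF g] by auto
  have "outside (path_image g) - A \<noteq> {}"
    using J(2) A(1) bounded_subset by auto
  then have "outside (path_image g) \<inter> frontier A \<noteq> {}"
    using connected_Int_frontier[OF J(1) ne] by simp
  then show False
    using A(2) outside_no_overlap by blast
qed

text \<open>
  The interior is connected as well, so it lies in \<open>A\<close> or misses \<open>A\<close>. In the second case \<open>A\<close> would be part of
  the curve, by the previous lemma. The third hypothesis on \<open>A\<close> excludes this; it holds for every
  set of positive area, as the curves considered here are null sets.
\<close>

lemma inside_subset_of_frontier:
  fixes g :: "real \<Rightarrow> complex"
  assumes g: "simple_path g" "pathfinish g = pathstart g"
    and A: "bounded A" "frontier A = path_image g" and thick: "\<not> A \<subseteq> path_image g"
  shows "inside (path_image g) \<subseteq> A"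
proof (rule ccontr)
  assume "\<not> inside (path_image g) \<subseteq> A"
  then have ne: "inside (path_image g) - A \<noteq> {}" by blast
  have J: "connected (inside (path_image g))"
    using Jordan_inside_outside[OF g] by auto
  obtain a where "a \<in> A" "a \<notin> path_image g" using thick by blast
  then have "a \<in> inside (path_image g)"
    using bounded_disjoint_outside[OF g A] inside_Un_outside[of "path_image g"] by blast
  then have "inside (path_image g) \<inter> frontier A \<noteq> {}"
    using connected_Int_frontier[OF J _ ne] \<open>a \<in> A\<close> by blast
  then show False
    using A(2) inside_no_overlap by blast
qed

text \<open>
  The winding number of \<open>h\<close> around a point of \<open>B - A\<close> off both curves is \<open>1\<close> or \<open>-1\<close>, that of \<open>g\<close> is \<open>0\<close>; so the
  straight-line homotopy between the loops must pass through the point.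
\<close>

lemma region_difference_covered_by_segments:
  fixes g h :: "real \<Rightarrow> complex"
  assumes g: "simple_path g" "pathfinish g = pathstart g"
    and A: "bounded A" "frontier A = path_image g" "\<not> A \<subseteq> path_image g"
    and h: "simple_path h" "pathfinish h = pathstart h"
    and B: "bounded B" "frontier B = path_image h"
  shows "B - A \<subseteq> (\<Union>t\<in>{0..1}. closed_segment (g t) (h t))"
proof
  fix p assume p: "p \<in> B - A"
  show "p \<in> (\<Union>t\<in>{0..1}. closed_segment (g t) (h t))"
  proof (rule ccontr)
    assume np: "p \<notin> (\<Union>t\<in>{0..1}. closed_segment (g t) (h t))"
    then have nog: "p \<notin> path_image g" and noh: "p \<notin> path_image h"
      by (auto simp: path_image_def)
    have "p \<in> inside (path_image h)"
      using bounded_disjoint_outside[OF h B] p noh inside_Un_outside[of "path_image h"] by blast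
    then have 1: "norm (winding_number h p) = 1"
      using simple_closed_path_norm_winding_number_inside[OF h(1)] by blast
    have "p \<in> outside (path_image g)"
      using inside_subset_of_frontier[OF g A] p nog inside_Un_outside[of "path_image g"] by blast
    then have 0: "winding_number g p = 0"
      using winding_number_zero_in_outside[OF simple_path_imp_path[OF g(1)] g(2)] by blast
    have "homotopic_loops (- {p}) g h"
      using np g h by (intro homotopic_loops_linear) (auto simp: simple_path_imp_path)
    then show False
      using winding_number_homotopic_loops 0 1 by fastforce
  qed
qed

text \<open>
  Winding numbers are defined for paths in the complex plane parametrized by \<open>[0, 1]\<close>. The following lemmas
  transport the previous result to closed curves in \<open>real \<times> real\<close> parametrized by \<open>[0, 2\<pi>]\<close>.
\<close>

definition to_complex :: "real \<times> real \<Rightarrow> complex" where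
  "to_complex p = Complex (fst p) (snd p)"

lemma linear_to_complex: "linear to_complex"
  by (rule linearI) (simp_all add: to_complex_def complex_eq_iff)

lemma inj_to_complex: "inj to_complex"
  by (rule injI) (simp add: to_complex_def prod_eq_iff)

lemma surj_to_complex: "surj to_complex"
  by (rule surjI[of _ "\<lambda>z. (Re z, Im z)"]) (simp add: to_complex_def)

lemma frontier_to_complex_image: "frontier (to_complex ` S) = to_complex ` frontier S"
  by (simp add: frontier_def closure_injective_linear_image interior_bijective_linear_image
      bij_def surj_to_complex linear_to_complex inj_to_complex image_set_diff)

definition loop_of :: "(real \<Rightarrow> real \<times> real) \<Rightarrow> real \<Rightarrow> complex" where
  "loop_of \<gamma> t = to_complex (\<gamma> (2 * pi * t))"

lemma loop_of_simple_closed: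
  assumes "simple_closed_piecewise_C1 \<gamma>"
  shows "simple_path (loop_of \<gamma>)" "pathfinish (loop_of \<gamma>) = pathstart (loop_of \<gamma>)"
    "path_image (loop_of \<gamma>) = to_complex ` curve_image \<gamma>"
proof -
  have cont: "continuous_on {0..2 * pi} \<gamma>" and closed: "\<gamma> (2 * pi) = \<gamma> 0"
    and inj: "inj_on \<gamma> {0..<2 * pi}"
    using assms by (auto simp: simple_closed_piecewise_C1_def piecewise_C1_def)
  show "pathfinish (loop_of \<gamma>) = pathstart (loop_of \<gamma>)"
    by (simp add: pathfinish_def pathstart_def loop_of_def closed)
  show "simple_path (loop_of \<gamma>)"
  proof
    have "continuous_on {0..1} (to_complex \<circ> (\<gamma> \<circ> (\<lambda>t. 2 * pi * t)))"
      by (intro continuous_on_compose linear_continuous_on continuous_intros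
          continuous_on_subset[OF cont])
        (use linear_to_complex in \<open>auto simp: linear_conv_bounded_linear\<close>)
    then show "path (loop_of \<gamma>)"
      by (simp add: path_def loop_of_def o_def)
  next
    fix s t :: real
    assume st: "0 \<le> s" "s < t" "t \<le> 1" "loop_of \<gamma> s = loop_of \<gamma> t"
    then have eq: "\<gamma> (2 * pi * s) = \<gamma> (2 * pi * t)"
      using inj_to_complex by (simp add: loop_of_def inj_eq)
    show "s = 0 \<and> t = 1"
    proof (cases "t = 1")
      case True
      then have "\<gamma> (2 * pi * s) = \<gamma> 0" using eq closed by simp
      then have "2 * pi * s = 0"
        using inj_onD[OF inj, of "2 * pi * s" 0] st by auto
      then show ?thesis using True by simp
    next
      case False
      then have "2 * pi * s = 2 * pi * t"
        using inj_onD[OF inj eq] st by auto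
      then show ?thesis using st by simp
    qed
  qed
  have "loop_of \<gamma> ` {0..1} = to_complex ` \<gamma> ` ((\<lambda>t. 2 * pi * t) ` {0..1})"
    by (simp only: image_image loop_of_def [abs_def])
  also have "(\<lambda>t. 2 * pi * t) ` {0..1} = {0..2 * pi}"
    by (subst image_mult_atLeastAtMost) auto
  also have "\<gamma> ` {0..2 * pi} = \<gamma> ` {0..<2 * pi}"
  proof
    show "\<gamma> ` {0..2 * pi} \<subseteq> \<gamma> ` {0..<2 * pi}"
    proof
      fix p assume "p \<in> \<gamma> ` {0..2 * pi}"
      then obtain s where s: "s \<in> {0..2 * pi}" "p = \<gamma> s" by blast
      show "p \<in> \<gamma> ` {0..<2 * pi}"
      proof (cases "s = 2 * pi")
        case True
        then show ?thesis using s closed by (intro image_eqI[of _ _ 0]) auto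
      next
        case False
        then show ?thesis using s by auto
      qed
    qed
  qed auto
  finally show "path_image (loop_of \<gamma>) = to_complex ` curve_image \<gamma>"
    by (simp add: path_image_def curve_image_def)
qed

definition swept_region :: "(real \<Rightarrow> real \<times> real) \<Rightarrow> (real \<Rightarrow> real \<times> real) \<Rightarrow> (real \<times> real) set" where
  "swept_region \<gamma> \<delta> = (\<Union>s\<in>{0..2 * pi}. closed_segment (\<gamma> s) (\<delta> s))"

lemma region_difference_subset_swept_region:
  assumes \<gamma>: "simple_closed_piecewise_C1 \<gamma>"
    and A: "bounded A" "frontier A = curve_image \<gamma>" "\<not> A \<subseteq> curve_image \<gamma>"
    and \<delta>: "simple_closed_piecewise_C1 \<delta>"
    and B: "bounded B" "frontier B = curve_image \<delta>"
  shows "B - A \<subseteq> swept_region \<gamma> \<delta>"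
proof
  fix p assume p: "p \<in> B - A"
  note inj = inj_image_mem_iff[OF inj_to_complex] inj_image_subset_iff[OF inj_to_complex]
  have bdd: "bounded (to_complex ` S)" if "bounded S" for S
    using that linear_to_complex bounded_linear_image linear_conv_bounded_linear by blast
  have "to_complex ` B - to_complex ` A \<subseteq>
      (\<Union>t\<in>{0..1}. closed_segment (loop_of \<gamma> t) (loop_of \<delta> t))"
    using A B by (intro region_difference_covered_by_segments loop_of_simple_closed \<gamma> \<delta>)
      (simp_all add: bdd loop_of_simple_closed \<gamma> \<delta> frontier_to_complex_image inj)
  moreover have "to_complex p \<in> to_complex ` B - to_complex ` A"
    using p by (simp add: inj)
  ultimately obtain t where t: "t \<in> {0..1}"
      "to_complex p \<in> closed_segment (loop_of \<gamma> t) (loop_of \<delta> t)"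
    by blast
  then have "p \<in> closed_segment (\<gamma> (2 * pi * t)) (\<delta> (2 * pi * t))"
    by (simp add: loop_of_def closed_segment_linear_image linear_to_complex inj)
  moreover have "2 * pi * t \<in> {0..2 * pi}" using t by simp
  ultimately show "p \<in> swept_region \<gamma> \<delta>"
    by (auto simp: swept_region_def)
qed

section \<open>The area of the swept region\<close>

lemma swept_region_eq_image:
  "swept_region \<gamma> \<delta> =
     (\<lambda>(s, t). (1 - t) *\<^sub>R \<gamma> s + t *\<^sub>R \<delta> s) ` ({0..2 * pi} \<times> {0..1})"
  by (fastforce simp: swept_region_def closed_segment_def)

lemma compact_swept_region:
  assumes "continuous_on {0..2 * pi} \<gamma>" "continuous_on {0..2 * pi} \<delta>"
  shows "compact (swept_region \<gamma> \<delta>)"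
  unfolding swept_region_eq_image case_prod_unfold
  by (intro compact_continuous_image compact_Times compact_Icc continuous_intros
      continuous_on_compose2[OF assms(1)] continuous_on_compose2[OF assms(2)]) auto

lemma negligible_closed_segment:
  fixes a b :: "'a::euclidean_space"
  assumes "2 \<le> DIM('a)"
  shows "negligible (closed_segment a b)"
  using assms by (simp add: negligible_convex_interior interior_closed_segment_ge2)

text \<open>
  The parametrization of the swept region by parameter \<open>s = v $ 1\<close> and homotopy time \<open>t = v $ 2\<close>, in the
  coordinates of \<open>real^2\<close>.
\<close>

definition sweep :: "(real \<Rightarrow> real \<times> real) \<Rightarrow> (real \<Rightarrow> real \<times> real) \<Rightarrow> real^2 \<Rightarrow> real^2" where
  "sweep \<gamma> \<delta> v = of_pair ((1 - v $ 2) *\<^sub>R \<gamma> (v $ 1) + v $ 2 *\<^sub>R \<delta> (v $ 1))"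

lemma has_derivative_sweep:
  assumes "(\<gamma> has_vector_derivative \<gamma>') (at (v $ 1))" "(\<delta> has_vector_derivative \<delta>') (at (v $ 1))"
  shows "(sweep \<gamma> \<delta> has_derivative
    (\<lambda>h. of_pair (h $ 1 *\<^sub>R ((1 - v $ 2) *\<^sub>R \<gamma>' + v $ 2 *\<^sub>R \<delta>') + h $ 2 *\<^sub>R (\<delta> (v $ 1) - \<gamma> (v $ 1))))) (at v within S)"
proof -
  have "bounded_linear (\<lambda>h::real^2. h $ 1)" by (rule bounded_linear_vec_nth)
  then have d1: "((\<lambda>h::real^2. h $ 1) has_derivative (\<lambda>h. h $ 1)) (at v within S)"
    by (rule bounded_linear_imp_has_derivative)
  have d2: "((\<lambda>h::real^2. h $ 2) has_derivative (\<lambda>h. h $ 2)) (at v within S)"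
    by (rule bounded_linear_imp_has_derivative[OF bounded_linear_vec_nth])
  have c: "((\<lambda>w. f (w $ 1)) has_derivative (\<lambda>h. h $ 1 *\<^sub>R f')) (at v within S)"
    if "(f has_vector_derivative f') (at (v $ 1))" for f :: "real \<Rightarrow> real \<times> real" and f'
    using that unfolding has_vector_derivative_def
    by (rule has_derivative_compose[OF d1, of f "\<lambda>x. x *\<^sub>R f'"])
  have "((\<lambda>w. (1 - w $ 2) *\<^sub>R \<gamma> (w $ 1) + w $ 2 *\<^sub>R \<delta> (w $ 1)) has_derivative
     (\<lambda>h. h $ 1 *\<^sub>R ((1 - v $ 2) *\<^sub>R \<gamma>' + v $ 2 *\<^sub>R \<delta>') + h $ 2 *\<^sub>R (\<delta> (v $ 1) - \<gamma> (v $ 1))))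
     (at v within S)"
    by (rule derivative_eq_intros c[OF assms(1)] c[OF assms(2)] d2 refl)+
      (simp add: algebra_simps scaleR_diff_left scaleR_diff_right)
  then show ?thesis
    unfolding sweep_def
    by (rule bounded_linear.has_derivative[OF linear_of_pair[THEN linear_conv_bounded_linear[THEN iffD1]]])
qed

lemma abs_cross_product_le:
  fixes a b c d :: real
  assumes "\<bar>a\<bar> \<le> k" "\<bar>b\<bar> \<le> k" "\<bar>c\<bar> \<le> e" "\<bar>d\<bar> \<le> e"
  shows "\<bar>a * d - c * b\<bar> \<le> 2 * k * e"
proof -
  have "\<bar>a * d\<bar> \<le> k * e" "\<bar>c * b\<bar> \<le> k * e"
    using assms mult_mono[of "\<bar>a\<bar>" k "\<bar>d\<bar>" e] mult_mono[of "\<bar>b\<bar>" k "\<bar>c\<bar>" e]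
    by (auto simp: abs_mult mult.commute)
  then show ?thesis by (simp add: abs_if split: if_splits)
qed

lemma abs_convex_combination_le:
  fixes a b t k :: real
  assumes "\<bar>a\<bar> \<le> k" "\<bar>b\<bar> \<le> k" "0 \<le> t" "t \<le> 1"
  shows "\<bar>(1 - t) * a + t * b\<bar> \<le> k"
  using convexD_alt[OF convex_real_interval(5)[of "-k" k], of a b t] assms by (simp add: abs_le_iff)

text \<open>
  At \<open>(s, t)\<close> the Jacobian determinant of the parametrization is the cross product of \<open>(1 - t) \<gamma>' s + t \<delta>' s\<close> with \<open>\<delta> s - \<gamma> s\<close>,
  so it is at most \<open>2 * k * e\<close> in absolute value; the rectangle of parameters has area \<open>2 * pi\<close>.
  The parameters in \<open>P\<close>, where a derivative may be missing, contribute only finitely many segments.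
\<close>

lemma measure_swept_region_le:
  assumes P: "finite P" "{0, 2 * pi} \<subseteq> P"
    and cont: "continuous_on {0..2 * pi} \<gamma>" "continuous_on {0..2 * pi} \<delta>"
    and deriv: "\<And>s. s \<in> {0..2 * pi} - P \<Longrightarrow> (\<gamma> has_vector_derivative \<gamma>' s) (at s)"
      "\<And>s. s \<in> {0..2 * pi} - P \<Longrightarrow> (\<delta> has_vector_derivative \<delta>' s) (at s)"
    and speed: "\<And>s. s \<in> {0..2 * pi} - P \<Longrightarrow> \<bar>fst (\<gamma>' s)\<bar> \<le> k \<and> \<bar>snd (\<gamma>' s)\<bar> \<le> k"
      "\<And>s. s \<in> {0..2 * pi} - P \<Longrightarrow> \<bar>fst (\<delta>' s)\<bar> \<le> k \<and> \<bar>snd (\<delta>' s)\<bar> \<le> k"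
    and gap: "\<And>s. s \<in> {0..2 * pi} - P \<Longrightarrow>
      \<bar>fst (\<delta> s - \<gamma> s)\<bar> \<le> e \<and> \<bar>snd (\<delta> s - \<gamma> s)\<bar> \<le> e"
    and nonneg: "0 \<le> k" "0 \<le> e"
  shows "measure lebesgue (swept_region \<gamma> \<delta>) \<le> 2 * pi * (2 * k * e)"
proof -
  define Q where "Q = cbox (0::real^2) (vector [2 * pi, 1])"
  define H where "H = (\<Union>p\<in>P. {v::real^2. v $ 1 = p})"
  define S where "S = Q - H"
  define F' where "F' = (\<lambda>(v::real^2) (h::real^2). of_pair (h $ 1 *\<^sub>R ((1 - v $ 2) *\<^sub>R \<gamma>' (v $ 1) + v $ 2 *\<^sub>R \<delta>' (v $ 1))
      + h $ 2 *\<^sub>R (\<delta> (v $ 1) - \<gamma> (v $ 1))))"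
  have inS: "v $ 1 \<in> {0..2 * pi} - P \<and> 0 \<le> v $ 2 \<and> v $ 2 \<le> 1" if "v \<in> S" for v
    using that by (auto simp: S_def Q_def H_def mem_box_cart forall_2)
  have negH: "negligible H"
  proof -
    have "negligible {v::real^2. v $ 1 = p}" for p
      using negligible_standard_hyperplane[of "axis 1 1 :: real^2" p]
      by (simp add: inner_axis axis_in_Basis_iff)
    then show ?thesis
      unfolding H_def using P(1) by (intro negligible_Union) auto
  qed
  have Q: "Q \<in> lmeasurable" by (simp add: Q_def)
  have S: "S \<in> lmeasurable"
    unfolding S_def using Q negligible_imp_measurable[OF negH] by (rule fmeasurable.Diff)
  have "measure lebesgue Q = 2 * pi"
  proof -
    have "cbox (0::real^2) (vector [2 * pi, 1]) \<noteq> {}"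
      by (simp add: interval_ne_empty_cart forall_2)
    then show ?thesis
      by (simp add: Q_def content_cbox_cart UNIV_2)
  qed
  moreover have "measure lebesgue S \<le> measure lebesgue Q"
    using S Q by (intro measure_mono_fmeasurable) (auto simp: S_def fmeasurableD)
  ultimately have mS: "measure lebesgue S \<le> 2 * pi" by simp
  have der: "(sweep \<gamma> \<delta> has_derivative F' v) (at v within S)" if "v \<in> S" for v
    unfolding F'_def using inS[OF that] by (intro has_derivative_sweep deriv) auto
  have det: "\<bar>det (matrix (F' v))\<bar> \<le> 2 * k * e" if "v \<in> S" for v
  proof -
    note s = inS[OF that]
    have "det (matrix (F' v)) =
       ((1 - v $ 2) * fst (\<gamma>' (v $ 1)) + v $ 2 * fst (\<delta>' (v $ 1))) * snd (\<delta> (v $ 1) - \<gamma> (v $ 1))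
       - fst (\<delta> (v $ 1) - \<gamma> (v $ 1)) * ((1 - v $ 2) * snd (\<gamma>' (v $ 1)) + v $ 2 * snd (\<delta>' (v $ 1)))"
      by (simp add: det_2 matrix_def F'_def of_pair_def axis_def)
    also have "\<bar>\<dots>\<bar> \<le> 2 * k * e"
      using s speed gap by (intro abs_cross_product_le abs_convex_combination_le) auto
    finally show ?thesis .
  qed
  have int: "(\<lambda>v. \<bar>det (matrix (F' v))\<bar>) integrable_on S"
  proof (rule measurable_bounded_by_integrable_imp_integrable)
    show "(\<lambda>v. \<bar>det (matrix (F' v))\<bar>) \<in> borel_measurable (lebesgue_on S)"
      using borel_measurable_det_Jacobian[OF fmeasurableD[OF S] der] by simp
    show "(\<lambda>v. 2 * k * e) integrable_on S"
      using S by (rule integrable_on_const)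
  qed (use det S in auto)
  have FS: "sweep \<gamma> \<delta> ` S \<in> lmeasurable"
    "measure lebesgue (sweep \<gamma> \<delta> ` S) \<le> (2 * k * e) * measure lebesgue S"
    using measurable_bounded_differentiable_image[OF S der int det]
      measure_bounded_differentiable_image[OF S der int det] by auto
  define N where "N = (\<Union>p\<in>P. of_pair ` closed_segment (\<gamma> p) (\<delta> p))"
  have negN: "negligible N"
    unfolding N_def using P(1)
    by (intro negligible_Union)
      (auto simp: closed_segment_linear_image[OF linear_of_pair, symmetric] negligible_closed_segment)
  have R: "swept_region \<gamma> \<delta> \<in> lmeasurable"
    using compact_swept_region[OF cont] by (rule lmeasurable_compact)
  have sub: "of_pair ` swept_region \<gamma> \<delta> \<subseteq> sweep \<gamma> \<delta> ` S \<union> N"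
  proof clarify
    fix a b
    assume *: "(a, b) \<in> swept_region \<gamma> \<delta>" "of_pair (a, b) \<notin> N"
    then obtain s t where st: "s \<in> {0..2 * pi}" "t \<in> {0..1}"
        "(a, b) = (1 - t) *\<^sub>R \<gamma> s + t *\<^sub>R \<delta> s"
      by (auto simp: swept_region_eq_image)
    have "s \<notin> P"
      using * st by (auto simp: N_def closed_segment_def)
    then have "vector [s, t] \<in> S"
      using st by (auto simp: S_def Q_def H_def mem_box_cart forall_2)
    moreover have "of_pair (a, b) = sweep \<gamma> \<delta> (vector [s, t])"
      by (simp add: sweep_def st(3))
    ultimately show "of_pair (a, b) \<in> sweep \<gamma> \<delta> ` S" by blast
  qed
  have "measure lebesgue (swept_region \<gamma> \<delta>) = measure lebesgue (of_pair ` swept_region \<gamma> \<delta>)"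
    using R by (simp add: measure_of_pair_image)
  also have "\<dots> \<le> measure lebesgue (sweep \<gamma> \<delta> ` S \<union> N)"
    using sub FS(1) negN lmeasurable_of_pair_image[OF R]
    by (intro measure_mono_fmeasurable) (auto simp: fmeasurableD negligible_imp_measurable)
  also have "\<dots> \<le> measure lebesgue (sweep \<gamma> \<delta> ` S) + measure lebesgue N"
    using FS(1) negN by (intro measure_Un_le) (auto simp: fmeasurableD negligible_imp_measurable)
  also have "measure lebesgue N = 0"
    using negN by (rule negligible_imp_measure0)
  also have "measure lebesgue (sweep \<gamma> \<delta> ` S) \<le> (2 * k * e) * (2 * pi)"
    using FS(2) mS nonneg by (meson mult_left_mono mult_nonneg_nonneg order_trans zero_le_numeral)
  finally show ?thesis by (simp add: algebra_simps)
qed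

section \<open>Derivatives of piecewise continuously differentiable curves\<close>

text \<open>
  Between consecutive points of the subdivision the curve agrees with a function that is \<open>C\<^sup>1\<close> on the closed
  piece, where its derivative is bounded by compactness; there are only finitely many pieces.
\<close>

lemma piecewise_C1_derivative:
  fixes f :: "real \<Rightarrow> 'a::real_normed_vector"
  assumes "piecewise_C1 f a b"
  obtains P f' C where "finite P" "{a, b} \<subseteq> P"
    "\<And>s. s \<in> {a..b} - P \<Longrightarrow> (f has_vector_derivative f' s) (at s) \<and> norm (f' s) \<le> C"
proof -
  obtain P where P: "finite P" "{a, b} \<subseteq> P" "P \<subseteq> {a..b}"
    and piece: "\<And>u v. u \<in> P \<Longrightarrow> v \<in> P \<Longrightarrow> u < v \<Longrightarrow> {u<..<v} \<inter> P = {} \<Longrightarrow>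
        \<exists>g. g C1_differentiable_on {u..v} \<and> (\<forall>t\<in>{u..v}. g t = f t)"
    using assms unfolding piecewise_C1_def by (elim conjE exE) metis
  define f' where "f' s = vector_derivative f (at s)" for s
  have "\<exists>C. \<forall>s\<in>{u<..<v}. (f has_vector_derivative f' s) (at s) \<and> norm (f' s) \<le> C"
    if uv: "u \<in> P" "v \<in> P" "u < v" "{u<..<v} \<inter> P = {}" for u v
  proof -
    obtain g where g: "g C1_differentiable_on {u..v}" "\<And>t. t \<in> {u..v} \<Longrightarrow> g t = f t"
      using piece[OF uv] by blast
    obtain D where D: "\<And>s. s \<in> {u..v} \<Longrightarrow> (g has_vector_derivative D s) (at s)"
      and cont: "continuous_on {u..v} D"
      using g(1) unfolding C1_differentiable_on_def by blast
    obtain C where C: "\<And>s. s \<in> {u..v} \<Longrightarrow> norm (D s) \<le> C"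
      using compact_imp_bounded[OF compact_continuous_image[OF cont compact_Icc]]
      unfolding bounded_iff by blast
    have "(f has_vector_derivative D s) (at s)" if "s \<in> {u<..<v}" for s
      using D[of s] that g(2)
      by (intro has_vector_derivative_transform_within_open[of g _ _ "{u<..<v}" f]) auto
    then have "f' s = D s \<and> (f has_vector_derivative D s) (at s)" if "s \<in> {u<..<v}" for s
      using that vector_derivative_at unfolding f'_def by blast
    then show ?thesis
      using C by (intro exI[of _ C]) auto
  qed
  then obtain C where C: "\<And>u v s. u \<in> P \<Longrightarrow> v \<in> P \<Longrightarrow> u < v \<Longrightarrow> {u<..<v} \<inter> P = {} \<Longrightarrow> s \<in> {u<..<v} \<Longrightarrow>
      (f has_vector_derivative f' s) (at s) \<and> norm (f' s) \<le> C u v"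
    by metis
  define K where "K = Max (case_prod C ` (P \<times> P))"
  show thesis
  proof (rule that[OF P(1,2)])
    fix s assume s: "s \<in> {a..b} - P"
    \<comment> \<open>The piece that contains \<open>s\<close> runs from the last point of \<open>P\<close> before \<open>s\<close> to the first one after \<open>s\<close>.\<close>
    define L where "L = {p \<in> P. p < s}"
    define R where "R = {p \<in> P. s < p}"
    have L: "finite L" "L \<noteq> {}" and R: "finite R" "R \<noteq> {}"
      using s P by (auto simp: L_def R_def order.strict_iff_order)
    have uv: "Max L \<in> P" "Max L < s" "Min R \<in> P" "s < Min R"
      using Max_in[OF L] Min_in[OF R] by (auto simp: L_def R_def)
    have "{Max L<..<Min R} \<inter> P = {}"
    proof (rule ccontr)
      assume "{Max L<..<Min R} \<inter> P \<noteq> {}"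
      then obtain p where p: "p \<in> P" "Max L < p" "p < Min R" by auto
      then have "p \<noteq> s" using s by auto
      then have "p \<in> L \<or> p \<in> R" using p by (auto simp: L_def R_def)
      then show False using p Max_ge[OF L(1), of p] Min_le[OF R(1), of p] by auto
    qed
    then have "(f has_vector_derivative f' s) (at s) \<and> norm (f' s) \<le> C (Max L) (Min R)"
      using uv by (intro C) auto
    moreover have "C (Max L) (Min R) \<le> K"
      unfolding K_def using P(1) uv by (intro Max_ge) (auto intro!: image_eqI[of _ _ "(Max L, Min R)"])
    ultimately show "(f has_vector_derivative f' s) (at s) \<and> norm (f' s) \<le> K" by simp
  qed
qed

lemma drv_eq:
  assumes "(f has_vector_derivative f') (at s)" "s \<in> {0<..<2 * pi}"
  shows "drv f s = f'" and "s \<in> drv_dom f"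
proof -
  have "s \<in> interior {0..<2 * pi}" using assms by simp
  then have eq: "at s within {0..<2 * pi} = at s" by (rule at_within_interior)
  show "drv f s = f'" using assms eq by (simp add: drv_def vector_derivative_at)
  show "s \<in> drv_dom f" using assms eq by (auto simp: drv_dom_def differentiableI_vector)
qed

text \<open>
  The derivative restricted to \<open>[0, 2\<pi>)\<close> may also exist at points of the subdivision, where the bound for the
  open pieces says nothing. These points are finitely many, so the derivatives stay bounded over all of
  \<open>drv_dom\<close>. Without this the suprema \<open>curve_eps\<close> and \<open>curve_M\<close> need not dominate their members.
\<close>

lemma simple_closed_drv:
  assumes "simple_closed_piecewise_C1 (\<lambda>s. (x s, y s))"
  obtains P where "finite P" "{0, 2 * pi} \<subseteq> P"
    "\<And>s. s \<in> {0..2 * pi} - P \<Longrightarrow> ((\<lambda>s. (x s, y s)) has_vector_derivative (drv x s, drv y s)) (at s)"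
    "\<And>s. s \<in> {0..2 * pi} - P \<Longrightarrow> s \<in> drv_dom x \<and> s \<in> drv_dom y"
    "bounded (drv x ` drv_dom x)" "bounded (drv y ` drv_dom y)"
proof -
  have "piecewise_C1 (\<lambda>s. (x s, y s)) 0 (2 * pi)"
    using assms by (simp add: simple_closed_piecewise_C1_def)
  then obtain P D C where P: "finite P" "{0, 2 * pi} \<subseteq> P"
    and D: "\<And>s. s \<in> {0..2 * pi} - P \<Longrightarrow>
        ((\<lambda>s. (x s, y s)) has_vector_derivative D s) (at s) \<and> norm (D s) \<le> C"
    using piecewise_C1_derivative by blast
  have *: "drv x s = fst (D s)" "s \<in> drv_dom x" "drv y s = snd (D s)" "s \<in> drv_dom y"
    if "s \<in> {0..2 * pi} - P" for s
  proof -
    have i: "s \<in> {0<..<2 * pi}"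
      using that P by (auto simp: order.strict_iff_order)
    have d: "(x has_vector_derivative fst (D s)) (at s)" "(y has_vector_derivative snd (D s)) (at s)"
      using D[OF that] bounded_linear.has_vector_derivative[OF bounded_linear_fst]
        bounded_linear.has_vector_derivative[OF bounded_linear_snd] by fastforce+
    show "drv x s = fst (D s)" "s \<in> drv_dom x" "drv y s = snd (D s)" "s \<in> drv_dom y"
      using drv_eq[OF d(1) i] drv_eq[OF d(2) i] by auto
  qed
  have bd: "bounded (drv f ` drv_dom f)"
    if "\<And>s. s \<in> {0..2 * pi} - P \<Longrightarrow> \<bar>drv f s\<bar> \<le> C" for f
  proof (rule bounded_subset)
    show "bounded ({-C..C} \<union> drv f ` P)"
      using P(1) by (simp add: finite_imp_bounded)
    show "drv f ` drv_dom f \<subseteq> {-C..C} \<union> drv f ` P"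
    proof clarify
      fix s assume s: "s \<in> drv_dom f" "drv f s \<notin> drv f ` P"
      then have "s \<in> {0..2 * pi} - P" by (auto simp: drv_dom_def)
      then show "drv f s \<in> {-C..C}" using that[of s] by (simp add: abs_le_iff)
    qed
  qed
  have comp: "\<bar>fst (D s)\<bar> \<le> C" "\<bar>snd (D s)\<bar> \<le> C" if "s \<in> {0..2 * pi} - P" for s
    using D[OF that] norm_fst_le[of "fst (D s)" "snd (D s)"] norm_snd_le[of "snd (D s)" "fst (D s)"]
    by auto
  show thesis
  proof (rule that[OF P])
    show "bounded (drv x ` drv_dom x)"
      by (rule bd) (simp add: *(1) comp(1))
    show "bounded (drv y ` drv_dom y)"
      by (rule bd) (simp add: *(3) comp(2))
  qed (use D * in auto)
qed

lemma bdd_above_abs_image: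
  assumes "bounded (f ` S)"
  shows "bdd_above ((\<lambda>s. \<bar>f s :: real\<bar>) ` S)"
  using assms by (auto simp: bounded_iff bdd_above_def)

lemma bdd_above_abs_diff_image:
  assumes "bounded (f ` S)" "bounded (g ` T)"
  shows "bdd_above ((\<lambda>s. \<bar>f s - g s :: real\<bar>) ` (S \<inter> T))"
proof -
  obtain B C where "\<And>s. s \<in> S \<Longrightarrow> \<bar>f s\<bar> \<le> B" "\<And>s. s \<in> T \<Longrightarrow> \<bar>g s\<bar> \<le> C"
    using assms by (auto simp: bounded_iff)
  then have "\<bar>f s - g s\<bar> \<le> B + C" if "s \<in> S \<inter> T" for s
    using that by (fastforce intro: order_trans[OF abs_triangle_ineq4] add_mono)
  then show ?thesis by (auto simp: bdd_above_def)
qed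

text \<open>
  Off finitely many parameters the curve is differentiable, and a differentiable image of a set of lower
  dimension is null. This makes the enclosed regions Jordan measurable.
\<close>

lemma negligible_curve_image:
  assumes "simple_closed_piecewise_C1 \<gamma>"
  shows "negligible (curve_image \<gamma>)"
proof -
  have "piecewise_C1 \<gamma> 0 (2 * pi)"
    using assms by (simp add: simple_closed_piecewise_C1_def)
  then obtain P \<gamma>' C where P: "finite P" "{0, 2 * pi} \<subseteq> P"
    and d: "\<And>s. s \<in> {0..2 * pi} - P \<Longrightarrow> (\<gamma> has_vector_derivative \<gamma>' s) (at s) \<and> norm (\<gamma>' s) \<le> C"
    by (rule piecewise_C1_derivative) blast
  have "\<gamma> differentiable_on ({0..2 * pi} - P)"
    using d by (meson differentiableI_vector differentiable_at_imp_differentiable_on)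
  then have "negligible (\<gamma> ` ({0..2 * pi} - P))"
    by (intro negligible_differentiable_image_lowdim) auto
  moreover have "negligible (\<gamma> ` P)" using P(1) by (simp add: negligible_finite)
  moreover have "curve_image \<gamma> \<subseteq> \<gamma> ` ({0..2 * pi} - P) \<union> \<gamma> ` P"
    by (auto simp: curve_image_def)
  ultimately show ?thesis by (meson negligible_Un negligible_subset)
qed

section \<open>Coherence of nearby regions\<close>

lemma simple_closed_bounded_coordinates:
  assumes "simple_closed_piecewise_C1 (\<lambda>s. (x s, y s))"
  shows "bounded (x ` {0..<2 * pi})" "bounded (y ` {0..<2 * pi})"
proof -
  have c: "continuous_on {0..2 * pi} (\<lambda>s. (x s, y s))"
    using assms by (simp add: simple_closed_piecewise_C1_def piecewise_C1_def)
  have "continuous_on {0..2 * pi} x" "continuous_on {0..2 * pi} y"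
    using continuous_on_fst[OF c] continuous_on_snd[OF c] by simp_all
  then have "bounded (x ` {0..2 * pi})" "bounded (y ` {0..2 * pi})"
    by (auto intro!: compact_imp_bounded compact_continuous_image)
  then show "bounded (x ` {0..<2 * pi})" "bounded (y ` {0..<2 * pi})"
    by (auto elim: bounded_subset[OF _ image_mono])
qed

text \<open>
  Specialization to \<open>k = curve_M / 2\<close> and \<open>e = curve_eps\<close>: the factor \<open>2\<close> in \<open>curve_M\<close> accounts for
  the two products in the Jacobian determinant.
\<close>

lemma measure_swept_region_le_curve_bounds:
  assumes \<gamma>: "simple_closed_piecewise_C1 (\<lambda>s. (x s, y s))"
    and \<delta>: "simple_closed_piecewise_C1 (\<lambda>s. (x\<^sub>2 s, y\<^sub>2 s))"
  shows "measure lebesgue (swept_region (\<lambda>s. (x s, y s)) (\<lambda>s. (x\<^sub>2 s, y\<^sub>2 s)))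
    \<le> 2 * pi * (curve_M x y x\<^sub>2 y\<^sub>2 * curve_eps x y x\<^sub>2 y\<^sub>2)"
proof -
  obtain P where P: "finite P" "{0, 2 * pi} \<subseteq> P"
    and d: "\<And>s. s \<in> {0..2 * pi} - P \<Longrightarrow> ((\<lambda>s. (x s, y s)) has_vector_derivative (drv x s, drv y s)) (at s)"
    and dom: "\<And>s. s \<in> {0..2 * pi} - P \<Longrightarrow> s \<in> drv_dom x \<and> s \<in> drv_dom y"
    and bd: "bounded (drv x ` drv_dom x)" "bounded (drv y ` drv_dom y)"
    using \<gamma> by (rule simple_closed_drv) blast
  obtain P\<^sub>2 where P\<^sub>2: "finite P\<^sub>2" "{0, 2 * pi} \<subseteq> P\<^sub>2"
    and d\<^sub>2: "\<And>s. s \<in> {0..2 * pi} - P\<^sub>2 \<Longrightarrow> ((\<lambda>s. (x\<^sub>2 s, y\<^sub>2 s)) has_vector_derivative (drv x\<^sub>2 s, drv y\<^sub>2 s)) (at s)"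
    and dom\<^sub>2: "\<And>s. s \<in> {0..2 * pi} - P\<^sub>2 \<Longrightarrow> s \<in> drv_dom x\<^sub>2 \<and> s \<in> drv_dom y\<^sub>2"
    and bd\<^sub>2: "bounded (drv x\<^sub>2 ` drv_dom x\<^sub>2)" "bounded (drv y\<^sub>2 ` drv_dom y\<^sub>2)"
    using \<delta> by (rule simple_closed_drv) blast
  note b = simple_closed_bounded_coordinates[OF \<gamma>] simple_closed_bounded_coordinates[OF \<delta>]
  have bddE: "bdd_above ((\<lambda>s. \<bar>x s - x\<^sub>2 s\<bar>) ` {0..<2 * pi} \<union>
          (\<lambda>s. \<bar>y s - y\<^sub>2 s\<bar>) ` {0..<2 * pi} \<union>
          (\<lambda>s. \<bar>drv x s - drv x\<^sub>2 s\<bar>) ` (drv_dom x \<inter> drv_dom x\<^sub>2) \<union>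
          (\<lambda>s. \<bar>drv y s - drv y\<^sub>2 s\<bar>) ` (drv_dom y \<inter> drv_dom y\<^sub>2))"
    using bdd_above_abs_diff_image[OF b(1) b(3)] bdd_above_abs_diff_image[OF b(2) b(4)]
      bdd_above_abs_diff_image[OF bd(1) bd\<^sub>2(1)] bdd_above_abs_diff_image[OF bd(2) bd\<^sub>2(2)]
    by simp
  have E: "\<bar>x s - x\<^sub>2 s\<bar> \<le> curve_eps x y x\<^sub>2 y\<^sub>2" "\<bar>y s - y\<^sub>2 s\<bar> \<le> curve_eps x y x\<^sub>2 y\<^sub>2"
    if "s \<in> {0..<2 * pi}" for s
    unfolding curve_eps_def using that by (auto intro!: cSup_upper[OF _ bddE])
  have bddM: "bdd_above (\<Union>f \<in> {x, x\<^sub>2, y, y\<^sub>2}.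
      (\<lambda>s. \<bar>f s\<bar>) ` {0..<2 * pi} \<union> (\<lambda>s. \<bar>drv f s\<bar>) ` drv_dom f)"
    using b bd bd\<^sub>2 by (auto intro!: bdd_above_abs_image)
  have M: "\<bar>drv f s\<bar> \<le> curve_M x y x\<^sub>2 y\<^sub>2 / 2"
    if "f \<in> {x, x\<^sub>2, y, y\<^sub>2}" "s \<in> drv_dom f" for f s
  proof -
    have "\<bar>drv f s\<bar> \<le> Sup (\<Union>f \<in> {x, x\<^sub>2, y, y\<^sub>2}.
      (\<lambda>s. \<bar>f s\<bar>) ` {0..<2 * pi} \<union> (\<lambda>s. \<bar>drv f s\<bar>) ` drv_dom f)"
      using that by (intro cSup_upper[OF _ bddM]) blast
    then show ?thesis by (simp add: curve_M_def)
  qed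
  have M0: "0 \<le> curve_M x y x\<^sub>2 y\<^sub>2"
  proof -
    have "\<bar>x 0\<bar> \<le> Sup (\<Union>f \<in> {x, x\<^sub>2, y, y\<^sub>2}.
      (\<lambda>s. \<bar>f s\<bar>) ` {0..<2 * pi} \<union> (\<lambda>s. \<bar>drv f s\<bar>) ` drv_dom f)"
      by (intro cSup_upper[OF _ bddM]) auto
    then show ?thesis by (simp add: curve_M_def)
  qed
  have E0: "0 \<le> curve_eps x y x\<^sub>2 y\<^sub>2"
    using E(1)[of 0] by auto
  have c: "continuous_on {0..2 * pi} (\<lambda>s. (x s, y s))" "continuous_on {0..2 * pi} (\<lambda>s. (x\<^sub>2 s, y\<^sub>2 s))"
    using \<gamma> \<delta> by (simp_all add: simple_closed_piecewise_C1_def piecewise_C1_def)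
  have "measure lebesgue (swept_region (\<lambda>s. (x s, y s)) (\<lambda>s. (x\<^sub>2 s, y\<^sub>2 s)))
      \<le> 2 * pi * (2 * (curve_M x y x\<^sub>2 y\<^sub>2 / 2) * curve_eps x y x\<^sub>2 y\<^sub>2)"
  proof (rule measure_swept_region_le[where P = "P \<union> P\<^sub>2" and \<gamma>' = "\<lambda>s. (drv x s, drv y s)"
          and \<delta>' = "\<lambda>s. (drv x\<^sub>2 s, drv y\<^sub>2 s)"])
    fix s assume s: "s \<in> {0..2 * pi} - (P \<union> P\<^sub>2)"
    have "s \<noteq> 2 * pi" using s P(2) by blast
    then have "s \<in> {0..<2 * pi}" using s by auto
    then show "\<bar>fst ((x\<^sub>2 s, y\<^sub>2 s) - (x s, y s))\<bar> \<le> curve_eps x y x\<^sub>2 y\<^sub>2 \<and>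
        \<bar>snd ((x\<^sub>2 s, y\<^sub>2 s) - (x s, y s))\<bar> \<le> curve_eps x y x\<^sub>2 y\<^sub>2"
      using E[of s] by (simp add: abs_minus_commute)
    show "\<bar>fst (drv x s, drv y s)\<bar> \<le> curve_M x y x\<^sub>2 y\<^sub>2 / 2 \<and> \<bar>snd (drv x s, drv y s)\<bar> \<le> curve_M x y x\<^sub>2 y\<^sub>2 / 2"
      "\<bar>fst (drv x\<^sub>2 s, drv y\<^sub>2 s)\<bar> \<le> curve_M x y x\<^sub>2 y\<^sub>2 / 2 \<and> \<bar>snd (drv x\<^sub>2 s, drv y\<^sub>2 s)\<bar> \<le> curve_M x y x\<^sub>2 y\<^sub>2 / 2"
      using s dom[of s] dom\<^sub>2[of s] M[of x s] M[of y s] M[of x\<^sub>2 s] M[of y\<^sub>2 s] by auto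
  qed (use P P\<^sub>2 c d d\<^sub>2 M0 E0 in auto)
  then show ?thesis by simp
qed

theorem theorem3p5:
  fixes x\<^sub>1 y\<^sub>1 x\<^sub>2 y\<^sub>2 x y :: "real \<Rightarrow> real"
    and A\<^sub>1 A\<^sub>2 A :: "(real \<times> real) set"
    and \<Phi> :: "real \<Rightarrow> real \<times> real \<Rightarrow> real \<times> real"
    and \<epsilon> M :: real and \<Delta> :: "real \<Rightarrow> real"
  assumes "area_preserving_flow \<Phi>"
    and "simple_closed_piecewise_C1 (\<lambda>s. (x\<^sub>1 s, y\<^sub>1 s))"
    and "simple_closed_piecewise_C1 (\<lambda>s. (x\<^sub>2 s, y\<^sub>2 s))"
    and "encloses (\<lambda>s. (x\<^sub>1 s, y\<^sub>1 s)) A\<^sub>1"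
    and "encloses (\<lambda>s. (x\<^sub>2 s, y\<^sub>2 s)) A\<^sub>2"
    and "A = A\<^sub>1 \<inter> A\<^sub>2" and "A \<noteq> {}" and "measure lebesgue A > 0"
    and "simple_closed_piecewise_C1 (\<lambda>s. (x s, y s))"
    and "frontier A = curve_image (\<lambda>s. (x s, y s))"
    and "\<epsilon> = curve_eps x y x\<^sub>2 y\<^sub>2"
    and "M = curve_M x y x\<^sub>2 y\<^sub>2"
    and "\<Delta> = (\<lambda>e. 2 * pi * M * e / measure lebesgue A\<^sub>2)"
  shows "1 \<ge> shape_coherence \<Phi> A\<^sub>1 A\<^sub>2 0 \<and> shape_coherence \<Phi> A\<^sub>1 A\<^sub>2 0 \<ge> 1 - \<Delta> \<epsilon>"
proof -
  have \<Phi>0: "\<Phi> 0 ` A\<^sub>1 = A\<^sub>1"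
    using assms(1) by (simp add: area_preserving_flow_def)
  have bounded: "bounded A\<^sub>1" "bounded A\<^sub>2" "bounded A"
    and fr: "frontier A\<^sub>1 = curve_image (\<lambda>s. (x\<^sub>1 s, y\<^sub>1 s))" "frontier A\<^sub>2 = curve_image (\<lambda>s. (x\<^sub>2 s, y\<^sub>2 s))"
    using assms(4,5,6) by (auto simp: encloses_def intro: bounded_subset)
  have lm: "A\<^sub>1 \<in> lmeasurable" "A\<^sub>2 \<in> lmeasurable" "A \<in> lmeasurable"
    using bounded fr assms(2,3,9,10) by (auto intro!: measurable_Jordan negligible_curve_image)
  have "measure lebesgue A \<le> measure lebesgue A\<^sub>2"
    using lm assms(6) by (intro measure_mono_fmeasurable) (auto simp: fmeasurableD)
  then have pos: "0 < measure lebesgue A\<^sub>2" using assms(8) by simp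
  have le1: "measure lebesgue (S ` A\<^sub>2 \<inter> \<Phi> 0 ` A\<^sub>1) / measure lebesgue A\<^sub>2 \<le> 1"
    if "S \<in> rigid_motions" for S
  proof -
    note SA = rigid_motion_lmeasurable[OF that lm(2)]
    have "measure lebesgue (S ` A\<^sub>2 \<inter> A\<^sub>1) \<le> measure lebesgue (S ` A\<^sub>2)"
      using SA lm(1) by (intro measure_mono_fmeasurable) (auto simp: fmeasurableD)
    then show ?thesis using SA pos by (simp add: \<Phi>0)
  qed
  have id_rigid: "id \<in> rigid_motions"
  proof -
    have id_eq: "id = (\<lambda>p :: real \<times> real. 0 + p)" by (simp add: fun_eq_iff)
    show ?thesis unfolding id_eq by (rule rigid_motions.translation)
  qed
  have "shape_coherence \<Phi> A\<^sub>1 A\<^sub>2 0 \<le> 1"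
    unfolding shape_coherence_def using id_rigid by (intro cSUP_least le1) auto
  moreover have "1 - \<Delta> \<epsilon> \<le> shape_coherence \<Phi> A\<^sub>1 A\<^sub>2 0"
  proof -
    define K where "K = swept_region (\<lambda>s. (x s, y s)) (\<lambda>s. (x\<^sub>2 s, y\<^sub>2 s))"
    have thick: "\<not> A \<subseteq> curve_image (\<lambda>s. (x s, y s))"
    proof
      assume "A \<subseteq> curve_image (\<lambda>s. (x s, y s))"
      then have "measure lebesgue A = 0"
        by (intro negligible_imp_measure0 negligible_subset[OF negligible_curve_image[OF assms(9)]])
      then show False using assms(8) by simp
    qed
    have cover: "A\<^sub>2 - A \<subseteq> K"
      unfolding K_def
      by (rule region_difference_subset_swept_region[OF assms(9) bounded(3) assms(10) thick
            assms(3) bounded(2) fr(2)])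
    have Kl: "K \<in> lmeasurable"
      unfolding K_def using assms(3,9)
      by (intro lmeasurable_compact compact_swept_region)
        (simp_all add: simple_closed_piecewise_C1_def piecewise_C1_def)
    have "measure lebesgue A\<^sub>2 \<le> measure lebesgue (A \<union> K)"
      using cover lm Kl by (intro measure_mono_fmeasurable) (auto simp: fmeasurableD)
    also have "\<dots> \<le> measure lebesgue A + measure lebesgue K"
      using lm Kl by (intro measure_Un_le) (auto simp: fmeasurableD)
    also have "measure lebesgue K \<le> 2 * pi * (M * \<epsilon>)"
      unfolding K_def assms(11,12) by (rule measure_swept_region_le_curve_bounds[OF assms(9,3)])
    finally have "1 \<le> (measure lebesgue A + 2 * pi * M * \<epsilon>) / measure lebesgue A\<^sub>2"
      using pos by (simp add: le_divide_eq mult.assoc)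
    then have "1 - \<Delta> \<epsilon> \<le> measure lebesgue A / measure lebesgue A\<^sub>2"
      unfolding assms(13) add_divide_distrib by linarith
    also have "\<dots> = measure lebesgue (id ` A\<^sub>2 \<inter> \<Phi> 0 ` A\<^sub>1) / measure lebesgue A\<^sub>2"
      by (simp add: \<Phi>0 assms(6) Int_commute)
    also have "\<dots> \<le> shape_coherence \<Phi> A\<^sub>1 A\<^sub>2 0"
      unfolding shape_coherence_def by (rule cSUP_upper[OF id_rigid bdd_aboveI2[OF le1]])
    finally show ?thesis .
  qed
  ultimately show ?thesis by simp
qed

end
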